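(* Let $P$ be an infinite row-finite or column-finite matrix and $A=\mathcal O(P)$ its output matrix. Assume that $P$ is a finite product (in some order) of matrices, each of one of the forms $\mathbf L(a_i,b_i,c_i)$, $\mathbf U(\widehat a_i,\widehat b_i,\widehat u_i,\widehat v_i)$, $\mathbf J(\widetilde a_i,\widetilde b_i,\widetilde u_i,\widetilde v_i,\lambda_i)$, or $\boldsymbol\Gamma^{(\Lambda,f_i(t))}$ ($i\ge1$), where all $a_i,b_i,c_i,\widehat a_i,\widehat b_i,\widehat u_i,\widehat v_i,\widetilde a_i,\widetilde b_i,\widetilde u_i,\widetilde v_i,\lambda_i$ are indeterminates and each $f_i(t)$ is an $\mathbf x$-Pólya frequency function of order $r$. Then: (i) the binomial row-generating matrix $A(q)=A\mathbf B_q$ is coefficientwise totally positive of order $r$ in all these indeterminates together with $\mathbf x$ and $q$; (ii) the row-generating polynomial sequence $(A_n(q))_{n\ge0}$, $A_n(q)=\sum_kA_{n,k}q^k$, is coefficientwise Hankel-totally positive of order $r$ in the same indeterminates.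
   Context: For a matrix $P=(p_{ij})_{i,j\ge0}$ (row-finite or column-finite), the output matrix $\mathcal O(P)=(a_{nk})_{n,k\ge0}$ is defined by $a_{nk}=(P^n)_{0k}$. $\mathbf B_q=[\binom nk q^{n-k}]_{n,k\ge0}$. $\mathbf L(a,b,c)$: lower-bidiagonal, diagonal entries $ka+b$ ($k\ge0$), $(k,k-1)$ entries $kc$. $\mathbf U(a,b,u,v)$: upper-bidiagonal, diagonal entries $ka+b$, $(k-1,k)$ entries $ku+v$ ($k\ge1$). $\mathbf J(a,b,u,v,\lambda)$: tridiagonal with $(n,n+1)$ entry $un+u+v$, $(n,n)$ entry $(2\lambda u+a)n+b+\lambda(u+v)$, $(n,n-1)$ entry $\lambda(a+\lambda u)n$. For $f(t)=\sum_{n\ge0}f_nt^n$, $\boldsymbol\Gamma^{(\Lambda,f)}=\Lambda\Gamma(f)\Lambda^{-1}=[\frac{i!}{j!}f_{i-j}]_{i,j}$ with $\Lambda=\mathrm{diag}(n!)$ and $\Gamma(f)=[f_{i-j}]$. $f$ is an $\mathbf x$-Pólya frequency function of order $r$ if $\Gamma(f)$ has all minors of size $\le r$ polynomials in $\mathbf x$ with nonnegative coefficients. Coefficientwise total positivity of order $r$: all minors of size $\le r$ are polynomials with nonnegative coefficients; coefficientwise Hankel-total positivity of order $r$ of a sequence: the same for $[a_{i+j}]_{i,j}$. *)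

theory Defs
  imports
    "Jordan_Normal_Form.Determinant"
    "HOL-Library.Poly_Mapping"
    "HOL-Computational_Algebra.Formal_Power_Series"
begin

text \<open>Polynomials with real coefficients in indeterminates of type \<open>'v\<close>: finitely supported
  maps from monomials (finitely supported exponent vectors) to coefficients, with the
  convolution product.\<close>

type_synonym 'v real_mpoly = "('v \<Rightarrow>\<^sub>0 nat) \<Rightarrow>\<^sub>0 real"

definition mp_const :: "real \<Rightarrow> 'v real_mpoly" where
  "mp_const c = Poly_Mapping.single 0 c"

definition mp_var :: "'v \<Rightarrow> 'v real_mpoly" where
  "mp_var v = Poly_Mapping.single (Poly_Mapping.single v 1) 1"

definition nonneg_poly_in :: "'v set \<Rightarrow> 'v real_mpoly \<Rightarrow> bool" where
  "nonneg_poly_in V p \<longleftrightarrow>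
     (\<forall>m. 0 \<le> Poly_Mapping.lookup p m) \<and> (\<forall>m \<in> Poly_Mapping.keys p. Poly_Mapping.keys m \<subseteq> V)"


type_synonym 'a inf_mat = "nat \<Rightarrow> nat \<Rightarrow> 'a"

definition row_finite :: "'a::zero inf_mat \<Rightarrow> bool" where
  "row_finite M \<longleftrightarrow> (\<forall>i. finite {j. M i j \<noteq> 0})"

definition col_finite :: "'a::zero inf_mat \<Rightarrow> bool" where
  "col_finite M \<longleftrightarrow> (\<forall>j. finite {i. M i j \<noteq> 0})"

text \<open>\<open>Sum_any\<close> is the sum over the support, and is meaningful only if the support is finite;
  this holds here whenever \<open>M\<close> is row-finite or \<open>N\<close> is column-finite.\<close>

definition inf_mult :: "'a::comm_ring_1 inf_mat \<Rightarrow> 'a inf_mat \<Rightarrow> 'a inf_mat" where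
  "inf_mult M N = (\<lambda>i j. Sum_any (\<lambda>k. M i k * N k j))"

definition inf_diag :: "(nat \<Rightarrow> 'a::zero) \<Rightarrow> 'a inf_mat" where
  "inf_diag d = (\<lambda>i j. if i = j then d i else 0)"

definition inf_one :: "'a::comm_ring_1 inf_mat" where
  "inf_one = inf_diag (\<lambda>_. 1)"

primrec inf_power :: "'a::comm_ring_1 inf_mat \<Rightarrow> nat \<Rightarrow> 'a inf_mat" where
  "inf_power M 0 = inf_one"
| "inf_power M (Suc n) = inf_mult (inf_power M n) M"

definition inf_prod_list :: "'a::comm_ring_1 inf_mat list \<Rightarrow> 'a inf_mat" where
  "inf_prod_list Ms = foldr inf_mult Ms inf_one"

definition output_matrix :: "'a::comm_ring_1 inf_mat \<Rightarrow> 'a inf_mat" where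
  "output_matrix P = (\<lambda>n k. inf_power P n 0 k)"

definition binomial_matrix :: "'a::comm_ring_1 \<Rightarrow> 'a inf_mat" where
  "binomial_matrix q = (\<lambda>n k. if k \<le> n then of_nat (n choose k) * q ^ (n - k) else 0)"

definition row_gen_poly :: "'a::comm_ring_1 inf_mat \<Rightarrow> 'a \<Rightarrow> nat \<Rightarrow> 'a" where
  "row_gen_poly A q n = Sum_any (\<lambda>k. A n k * q ^ k)"


definition L_mat :: "'a::comm_ring_1 \<Rightarrow> 'a \<Rightarrow> 'a \<Rightarrow> 'a inf_mat" where
  "L_mat a b c = (\<lambda>n k.
     if k = n then of_nat n * a + b
     else if n = k + 1 then of_nat n * c
     else 0)"

definition U_mat :: "'a::comm_ring_1 \<Rightarrow> 'a \<Rightarrow> 'a \<Rightarrow> 'a \<Rightarrow> 'a inf_mat" where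
  "U_mat a b u v = (\<lambda>n k.
     if k = n then of_nat n * a + b
     else if k = n + 1 then of_nat k * u + v
     else 0)"

definition J_mat :: "'a::comm_ring_1 \<Rightarrow> 'a \<Rightarrow> 'a \<Rightarrow> 'a \<Rightarrow> 'a \<Rightarrow> 'a inf_mat" where
  "J_mat a b u v l = (\<lambda>n k.
     if k = n + 1 then u * of_nat n + u + v
     else if k = n then (2 * l * u + a) * of_nat n + b + l * (u + v)
     else if n = k + 1 then l * (a + l * u) * of_nat n
     else 0)"

definition toeplitz :: "'a::comm_ring_1 fps \<Rightarrow> 'a inf_mat" where
  "toeplitz f = (\<lambda>i j. if j \<le> i then fps_nth f (i - j) else 0)"

definition Gamma_Lambda :: "'v real_mpoly fps \<Rightarrow> 'v real_mpoly inf_mat" where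
  "Gamma_Lambda f =
     inf_mult (inf_mult (inf_diag (\<lambda>n. mp_const (fact n))) (toeplitz f))
       (inf_diag (\<lambda>n. mp_const (1 / fact n)))"

lemma inf_mult_diag_left: "inf_mult (inf_diag d) M i j = d i * M i j"
proof -
  have "Sum_any (\<lambda>k. inf_diag d i k * M k j) = (\<Sum>k\<in>{i}. inf_diag d i k * M k j)"
    by (rule Sum_any.expand_superset) (auto simp: inf_diag_def)
  then show ?thesis by (simp add: inf_mult_def inf_diag_def)
qed

lemma inf_mult_diag_right: "inf_mult M (inf_diag d) i j = M i j * d j"
proof -
  have "Sum_any (\<lambda>k. M i k * inf_diag d k j) = (\<Sum>k\<in>{j}. M i k * inf_diag d k j)"
    by (rule Sum_any.expand_superset) (auto simp: inf_diag_def)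
  then show ?thesis by (simp add: inf_mult_def inf_diag_def)
qed

lemma Gamma_Lambda_entry:
  "Gamma_Lambda f i j = mp_const (fact i / fact j) * toeplitz f i j"
proof -
  have "mp_const (fact i / fact j) = (mp_const (fact i) * mp_const (1 / fact j) :: 'a real_mpoly)"
    by (simp add: mp_const_def Poly_Mapping.mult_single)
  then show ?thesis
    by (simp only: Gamma_Lambda_def inf_mult_diag_left inf_mult_diag_right mult_ac)
qed


definition minor :: "'a::comm_ring_1 inf_mat \<Rightarrow> nat \<Rightarrow> (nat \<Rightarrow> nat) \<Rightarrow> (nat \<Rightarrow> nat) \<Rightarrow> 'a" where
  "minor M k \<rho> \<sigma> = Determinant.det (Matrix.mat k k (\<lambda>(i, j). M (\<rho> i) (\<sigma> j)))"

definition coeffwise_TP :: "'v set \<Rightarrow> nat \<Rightarrow> 'v real_mpoly inf_mat \<Rightarrow> bool" where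
  "coeffwise_TP V r M \<longleftrightarrow>
     (\<forall>k \<rho> \<sigma>. k \<le> r \<and> strict_mono_on {..<k} \<rho> \<and> strict_mono_on {..<k} \<sigma>
        \<longrightarrow> nonneg_poly_in V (minor M k \<rho> \<sigma>))"

definition coeffwise_Hankel_TP :: "'v set \<Rightarrow> nat \<Rightarrow> (nat \<Rightarrow> 'v real_mpoly) \<Rightarrow> bool" where
  "coeffwise_Hankel_TP V r a \<longleftrightarrow> coeffwise_TP V r (\<lambda>i j. a (i + j))"

definition polya_frequency :: "'v set \<Rightarrow> nat \<Rightarrow> 'v real_mpoly fps \<Rightarrow> bool" where
  "polya_frequency V r f \<longleftrightarrow> coeffwise_TP V r (toeplitz f)"


text \<open>The indeterminates: \<open>IX x\<close> ranges over the family \<open>\<^bold>x\<close>, \<open>IQ\<close> is \<open>q\<close>, and the remaining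
  constructors are the parameters of the \<open>i\<close>-th matrices \<open>\<^bold>L\<close>, \<open>\<^bold>U\<close>, \<open>\<^bold>J\<close>.\<close>

datatype 'x indet =
    IX 'x
  | IQ
  | La nat | Lb nat | Lc nat
  | Ua nat | Ub nat | Uu nat | Uv nat
  | Ja nat | Jb nat | Ju nat | Jv nat | Jl nat

definition x_indets :: "'x indet set" where
  "x_indets = {IX x | x. True}"

definition L_fac :: "nat \<Rightarrow> 'x indet real_mpoly inf_mat" where
  "L_fac i = L_mat (mp_var (La i)) (mp_var (Lb i)) (mp_var (Lc i))"

definition U_fac :: "nat \<Rightarrow> 'x indet real_mpoly inf_mat" where
  "U_fac i = U_mat (mp_var (Ua i)) (mp_var (Ub i)) (mp_var (Uu i)) (mp_var (Uv i))"

definition J_fac :: "nat \<Rightarrow> 'x indet real_mpoly inf_mat" where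
  "J_fac i = J_mat (mp_var (Ja i)) (mp_var (Jb i)) (mp_var (Ju i)) (mp_var (Jv i)) (mp_var (Jl i))"

definition factor_matrices ::
    "(nat \<Rightarrow> 'x indet real_mpoly fps) \<Rightarrow> 'x indet real_mpoly inf_mat set" where
  "factor_matrices f = (\<Union>i \<in> {1..}. {L_fac i, U_fac i, J_fac i, Gamma_Lambda (f i)})"

end

theory Submission
  imports Defs
begin

text \<open>All factors are row-finite, and conjugation by \<open>B = B\<^sub>q\<close> maps each of them to a matrix that is
  coefficientwise totally positive of order \<open>r\<close>: \<open>B\<^sup>-\<^sup>1 L(a,b,c) B = L(a,b,c+qa)\<close>,
  \<open>B\<^sup>-\<^sup>1 J(a,b,u,v,\<lambda>) B = J(a,b,u,v,\<lambda>+q)\<close>, \<open>U(a,b,u,v) = J(a,b,u,v,0)\<close>, and the matrices \<open>\<Gamma>\<close>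
  commute with \<open>B\<close>, which is one of them. Hence \<open>Q = B\<^sup>-\<^sup>1 P B\<close> is totally positive of order \<open>r\<close> by the
  Cauchy-Binet formula, and \<open>A B\<close> is the output matrix of \<open>Q\<close>, because the first row of \<open>B\<close> is
  \<open>(1, 0, 0, \<dots>)\<close>. Total positivity passes from \<open>Q\<close> to its output matrix, and to the Hankel matrix of
  \<open>A\<^sub>n(q) = (Q\<^sup>n)\<^sub>0\<^sub>0\<close> since \<open>(Q\<^sup>n\<^sup>+\<^sup>m)\<^sub>0\<^sub>0 = \<Sum>\<^sub>k (Q\<^sup>n)\<^sub>0\<^sub>k (Q\<^sup>m)\<^sub>k\<^sub>0\<close>.\<close>

subsection \<open>Minors and the Cauchy-Binet formula\<close>

lemma minor_alt:
  "minor M k \<rho> \<sigma> = (\<Sum>p | p permutes {0..<k}. signof p * (\<Prod>i=0..<k. M (\<rho> i) (\<sigma> (p i))))"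
proof -
  have "(\<Prod>i=0..<k. Matrix.mat k k (\<lambda>(i, j). M (\<rho> i) (\<sigma> j)) $$ (i, p i)) = (\<Prod>i=0..<k. M (\<rho> i) (\<sigma> (p i)))"
    if "p permutes {0..<k}" for p
    by (rule prod.cong) (use permutes_in_image[OF that] in auto)
  then show ?thesis
    by (simp add: minor_def Determinant.det_def)
qed

lemma minor_cong:
  assumes "\<And>i j. i < k \<Longrightarrow> j < k \<Longrightarrow> M (\<rho> i) (\<sigma> j) = M' (\<rho>' i) (\<sigma>' j)"
  shows "minor M k \<rho> \<sigma> = minor M' k \<rho>' \<sigma>'"
  unfolding minor_def using assms by (intro arg_cong[of _ _ Determinant.det] cong_mat) auto

lemma minor_0 [simp]: "minor M 0 \<rho> \<sigma> = 1"
  by (simp add: minor_def)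

lemma minor_transpose: "minor (\<lambda>i j. M j i) k \<rho> \<sigma> = minor M k \<sigma> \<rho>"
proof -
  let ?A = "Matrix.mat k k (\<lambda>(i, j). M (\<sigma> i) (\<rho> j))"
  have "Matrix.mat k k (\<lambda>(i, j). M (\<sigma> j) (\<rho> i)) = transpose_mat ?A"
    by auto
  then show ?thesis
    unfolding minor_def by (simp add: Determinant.det_transpose[of ?A k])
qed

lemma minor_permute_rows:
  assumes "p permutes {0..<k}"
  shows "minor M k (\<lambda>i. \<rho> (p i)) \<sigma> = signof p * minor M k \<rho> \<sigma>"
proof -
  let ?A = "Matrix.mat k k (\<lambda>(i, j). M (\<rho> i) (\<sigma> j))"
  have "Matrix.mat k k (\<lambda>(i, j). M (\<rho> (p i)) (\<sigma> j)) = Matrix.mat k k (\<lambda>(i, j). ?A $$ (p i, j))"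
    using permutes_in_image[OF assms] by (intro cong_mat) auto
  then show ?thesis
    unfolding minor_def using Determinant.det_permute_rows[of ?A k p] assms by simp
qed

lemma minor_repeated_row:
  assumes "\<not> inj_on \<rho> {0..<k}"
  shows "minor M k \<rho> \<sigma> = 0"
proof -
  obtain i j where "i < k" "j < k" "i \<noteq> j" "\<rho> i = \<rho> j"
    using assms by (auto simp: inj_on_def)
  then show ?thesis
    unfolding minor_def by (intro Determinant.det_identical_rows[of _ k i j]) auto
qed

lemma minor_scale:
  "minor (\<lambda>i j. d i * e j * M i j) k \<rho> \<sigma> = (\<Prod>i=0..<k. d (\<rho> i)) * (\<Prod>j=0..<k. e (\<sigma> j)) * minor M k \<rho> \<sigma>"
proof -
  have "(\<Prod>i=0..<k. d (\<rho> i) * e (\<sigma> (p i)) * M (\<rho> i) (\<sigma> (p i)))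
      = (\<Prod>i=0..<k. d (\<rho> i)) * (\<Prod>j=0..<k. e (\<sigma> j)) * (\<Prod>i=0..<k. M (\<rho> i) (\<sigma> (p i)))"
    if "p permutes {0..<k}" for p
    \<comment> \<open>The column weights occur once each whatever \<open>p\<close> is, so they
      factor out of the whole Leibniz sum.\<close>
    using prod.permute[OF that, of "\<lambda>j. e (\<sigma> j)"] by (simp add: prod.distrib comp_def)
  then show ?thesis
    unfolding minor_alt by (auto simp: sum_distrib_left mult_ac intro!: sum.cong)
qed

lemma minor_row_eq_unit:
  assumes "\<And>j. 0 < j \<Longrightarrow> j < Suc k \<Longrightarrow> M (\<rho> 0) (\<sigma> j) = 0"
  shows "minor M (Suc k) \<rho> \<sigma> = M (\<rho> 0) (\<sigma> 0) * minor M k (\<lambda>i. \<rho> (Suc i)) (\<lambda>j. \<sigma> (Suc j))"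
proof -
  let ?A = "Matrix.mat (Suc k) (Suc k) (\<lambda>(i, j). M (\<rho> i) (\<sigma> j))"
  have "mat_delete ?A 0 0 = Matrix.mat k k (\<lambda>(i, j). M (\<rho> (Suc i)) (\<sigma> (Suc j)))"
    by (auto simp: mat_delete_def)
  moreover have "Determinant.det ?A = (\<Sum>j<Suc k. ?A $$ (0, j) * cofactor ?A 0 j)"
    by (rule laplace_expansion_row) auto
  moreover have "\<dots> = (\<Sum>j\<in>{0}. ?A $$ (0, j) * cofactor ?A 0 j)"
    by (rule sum.mono_neutral_right) (use assms in auto)
  ultimately show ?thesis
    by (simp add: minor_def cofactor_def)
qed

text \<open>An injection of \<open>{0..<k}\<close> is determined by its image \<open>S\<close> and
  the order \<open>p\<close> in which it visits \<open>S\<close>, relative to the increasing listing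
  \<open>enumerate S\<close>. The restriction makes the functions elements of the extensional
  function space over which products of sums expand.\<close>

lemma bij_betw_enumerate_permutes:
  "bij_betw (\<lambda>(S, p). restrict (\<lambda>i. enumerate S (p i)) {0..<k})
     ({S. S \<subseteq> {..<n} \<and> card S = k} \<times> {p. p permutes {0..<k}})
     {\<phi> \<in> {0..<k} \<rightarrow>\<^sub>E {..<n::nat}. inj_on \<phi> {0..<k}}"
  (is "bij_betw ?h (?S \<times> ?P) ?F")
proof -
  have fin: "finite S" if "S \<in> ?S" for S
    using that finite_subset by auto
  have enum: "bij_betw (enumerate S) {0..<k} S" if "S \<in> ?S" for S
    using finite_bij_enumerate[OF fin[OF that]] that by (simp add: lessThan_atLeast0)
  have comp: "bij_betw (\<lambda>i. enumerate S (p i)) {0..<k} S" if "S \<in> ?S" "p \<in> ?P" for S p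
    using bij_betw_trans[OF permutes_imp_bij enum[OF that(1)], of p] that(2) by (simp add: comp_def)
  have img: "?h (S, p) ` {0..<k} = S" if "S \<in> ?S" "p \<in> ?P" for S p
    using comp[OF that] by (simp add: bij_betw_def)
  have "inj_on ?h (?S \<times> ?P)"
  proof (rule inj_onI)
    fix x y assume xy: "x \<in> ?S \<times> ?P" "y \<in> ?S \<times> ?P" and eq: "?h x = ?h y"
    obtain S p S' p' where x: "x = (S, p)" and y: "y = (S', p')"
      by (cases x, cases y)
    have S: "S \<in> ?S" "S' \<in> ?S" and p: "p \<in> ?P" "p' \<in> ?P"
      using xy x y by auto
    have "S = S'"
      using img[OF S(1) p(1)] img[OF S(2) p(2)] eq unfolding x y by metis
    have "p i = p' i" for i
    proof (cases "i \<in> {0..<k}")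
      case True
      then have "enumerate S (p i) = enumerate S (p' i)"
        using fun_cong[OF eq, of i] unfolding x y \<open>S = S'\<close> by simp
      moreover have "p i \<in> {0..<k}" "p' i \<in> {0..<k}"
        using True p permutes_in_image by (metis mem_Collect_eq)+
      ultimately show ?thesis
        using enum[OF S(1)] unfolding bij_betw_def inj_on_def by blast
    next
      case False
      then show ?thesis
        using p permutes_not_in by (metis mem_Collect_eq)
    qed
    then show "x = y"
      using x y \<open>S = S'\<close> by blast
  qed
  moreover have "?h (S, p) \<in> ?F" if "S \<in> ?S" "p \<in> ?P" for S p
  proof -
    have "inj_on (?h (S, p)) {0..<k}"
      using comp[OF that] unfolding bij_betw_def inj_on_def by simp
    moreover have "?h (S, p) i \<in> {..<n}" if "i \<in> {0..<k}" for i
      using that img[OF \<open>S \<in> ?S\<close> \<open>p \<in> ?P\<close>] \<open>S \<in> ?S\<close> by blast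
    ultimately show ?thesis by simp
  qed
  moreover have "\<phi> \<in> ?h ` (?S \<times> ?P)" if "\<phi> \<in> ?F" for \<phi>
  proof -
    define S where "S = \<phi> ` {0..<k}"
    \<comment> \<open>\<open>p i\<close> is the rank of \<open>\<phi> i\<close> in the increasing
      listing of \<open>S\<close>; outside \<open>{0..<k}\<close> it must be the identity for
      \<open>permutes\<close> to hold.\<close>
    define p where "p = (\<lambda>i. if i \<in> {0..<k} then inv_into {0..<k} (enumerate S) (\<phi> i) else i)"
    have S: "S \<in> ?S"
      using that by (auto simp: S_def card_image)
    have "bij_betw \<phi> {0..<k} S"
      using that by (simp add: S_def bij_betw_def)
    then have "bij_betw (inv_into {0..<k} (enumerate S) \<circ> \<phi>) {0..<k} {0..<k}"
      using bij_betw_trans bij_betw_inv_into[OF enum[OF S]] by blast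
    then have "bij_betw p {0..<k} {0..<k}"
      by (subst bij_betw_cong[where g = "inv_into {0..<k} (enumerate S) \<circ> \<phi>"]) (auto simp: p_def)
    then have "p permutes {0..<k}"
      by (rule bij_imp_permutes) (auto simp: p_def)
    moreover have "\<phi> = ?h (S, p)"
    proof
      fix i
      show "\<phi> i = ?h (S, p) i"
        using that enum[OF S]
        by (cases "i < k") (auto simp: p_def S_def bij_betw_def f_inv_into_f PiE_def extensional_def)
    qed
    ultimately show ?thesis using S by blast
  qed
  ultimately show ?thesis
    unfolding bij_betw_def by blast
qed

text \<open>Expanding the product of row sums gives a sum over functions \<open>\<phi>\<close>
  choosing an inner index for each row. For fixed \<open>\<phi>\<close> the sum over permutations is
  a minor of \<open>N\<close>; grouping the \<open>\<phi>\<close> by their image then produces the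
  minors of \<open>M\<close>.\<close>

theorem Cauchy_Binet:
  "minor (\<lambda>i j. \<Sum>l<n. M i l * N l j) k \<rho> \<sigma>
     = (\<Sum>S | S \<subseteq> {..<n} \<and> card S = k. minor M k \<rho> (enumerate S) * minor N k (enumerate S) \<sigma>)"
proof -
  let ?P = "{p. p permutes {0..<k}}" and ?S = "{S. S \<subseteq> {..<n} \<and> card S = k}"
  let ?E = "{0..<k} \<rightarrow>\<^sub>E {..<n}"
  let ?T = "\<lambda>\<phi>. (\<Prod>i=0..<k. M (\<rho> i) (\<phi> i)) * minor N k \<phi> \<sigma>"
  have "minor (\<lambda>i j. \<Sum>l<n. M i l * N l j) k \<rho> \<sigma>
      = (\<Sum>p\<in>?P. \<Sum>\<phi>\<in>?E. signof p * (\<Prod>i=0..<k. M (\<rho> i) (\<phi> i) * N (\<phi> i) (\<sigma> (p i))))"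
    unfolding minor_alt by (simp add: prod_sum_PiE sum_distrib_left)
  also have "\<dots> = (\<Sum>\<phi>\<in>?E. \<Sum>p\<in>?P. signof p * (\<Prod>i=0..<k. M (\<rho> i) (\<phi> i) * N (\<phi> i) (\<sigma> (p i))))"
    by (rule sum.swap)
  also have "\<dots> = (\<Sum>\<phi>\<in>?E. ?T \<phi>)"
    unfolding minor_alt by (simp add: prod.distrib sum_distrib_left mult_ac)
  \<comment> \<open>A \<open>\<phi>\<close> that takes a value twice selects a repeated row of
    \<open>N\<close>.\<close>
  also have "\<dots> = (\<Sum>\<phi>\<in>{\<phi> \<in> ?E. inj_on \<phi> {0..<k}}. ?T \<phi>)"
    by (rule sum.mono_neutral_right) (auto simp: finite_PiE minor_repeated_row)
  also have "\<dots> = (\<Sum>(S, p)\<in>?S \<times> ?P. ?T (restrict (\<lambda>i. enumerate S (p i)) {0..<k}))"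
    by (subst sum.reindex_bij_betw[OF bij_betw_enumerate_permutes, symmetric]) (simp add: case_prod_unfold)
  also have "\<dots> = (\<Sum>(S, p)\<in>?S \<times> ?P.
      signof p * (\<Prod>i=0..<k. M (\<rho> i) (enumerate S (p i))) * minor N k (enumerate S) \<sigma>)"
  proof (rule sum.cong[OF refl], unfold case_prod_unfold)
    fix x assume x: "x \<in> ?S \<times> ?P"
    define S p where "S = fst x" and "p = snd x"
    have p: "p permutes {0..<k}"
      using x by (auto simp: p_def)
    have "minor N k (restrict (\<lambda>i. enumerate S (p i)) {0..<k}) \<sigma> = minor N k (\<lambda>i. enumerate S (p i)) \<sigma>"
      by (rule minor_cong) simp
    then have "?T (restrict (\<lambda>i. enumerate S (p i)) {0..<k})
        = signof p * (\<Prod>i=0..<k. M (\<rho> i) (enumerate S (p i))) * minor N k (enumerate S) \<sigma>"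
      \<comment> \<open>Sorting the rows of the minor of \<open>N\<close> costs the sign of
        \<open>p\<close>, exactly the sign missing from the Leibniz term of
        \<open>M\<close>.\<close>
      using minor_permute_rows[OF p, of N "enumerate S" \<sigma>] by (simp add: mult_ac)
    then show "?T (restrict (\<lambda>i. enumerate (fst x) (snd x i)) {0..<k})
        = signof (snd x) * (\<Prod>i=0..<k. M (\<rho> i) (enumerate (fst x) (snd x i))) * minor N k (enumerate (fst x)) \<sigma>"
      by (simp add: S_def p_def)
  qed
  also have "\<dots> = (\<Sum>S\<in>?S. minor M k \<rho> (enumerate S) * minor N k (enumerate S) \<sigma>)"
    unfolding minor_alt[of M] by (simp add: sum.cartesian_product[symmetric] sum_distrib_right)
  finally show ?thesis .
qed

subsection \<open>Coefficientwise total positivity\<close>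

lemma nonneg_poly_in_UNIV: "nonneg_poly_in V p \<Longrightarrow> nonneg_poly_in UNIV p"
  by (simp add: nonneg_poly_in_def)

lemma nonneg_poly_in_0 [simp]: "nonneg_poly_in V 0"
  by (simp add: nonneg_poly_in_def)

lemma nonneg_poly_in_mp_const: "0 \<le> c \<Longrightarrow> nonneg_poly_in V (mp_const c)"
  by (simp add: nonneg_poly_in_def mp_const_def lookup_single when_def)

lemma nonneg_poly_in_1 [simp]: "nonneg_poly_in V 1"
  by (simp add: nonneg_poly_in_def lookup_one when_def)

lemma nonneg_poly_in_mp_var: "v \<in> V \<Longrightarrow> nonneg_poly_in V (mp_var v)"
  by (simp add: nonneg_poly_in_def mp_var_def lookup_single when_def)

lemma nonneg_poly_in_add:
  "nonneg_poly_in V p \<Longrightarrow> nonneg_poly_in V q \<Longrightarrow> nonneg_poly_in V (p + q)"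
  using Poly_Mapping.keys_add[of p q] unfolding nonneg_poly_in_def by (fastforce simp: lookup_add)

lemma nonneg_poly_in_mult:
  assumes "nonneg_poly_in V p" "nonneg_poly_in V q"
  shows "nonneg_poly_in V (p * q)"
  unfolding nonneg_poly_in_def
proof (intro conjI allI ballI)
  fix m
  show "0 \<le> Poly_Mapping.lookup (p * q) m"
    using assms unfolding lookup_mult Sum_any.expand_set nonneg_poly_in_def
    by (intro sum_nonneg mult_nonneg_nonneg) (auto simp: when_def)
next
  fix m assume "m \<in> Poly_Mapping.keys (p * q)"
  then obtain a b where "m = a + b" "a \<in> Poly_Mapping.keys p" "b \<in> Poly_Mapping.keys q"
    using Poly_Mapping.keys_mult[of p q] by blast
  then show "Poly_Mapping.keys m \<subseteq> V"
    using assms Poly_Mapping.keys_add[of a b] unfolding nonneg_poly_in_def by blast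
qed

lemma nonneg_poly_in_sum:
  "(\<And>x. x \<in> S \<Longrightarrow> nonneg_poly_in V (g x)) \<Longrightarrow> nonneg_poly_in V (sum g S)"
  by (induction S rule: infinite_finite_induct) (auto intro: nonneg_poly_in_add)

lemma nonneg_poly_in_prod:
  "(\<And>x. x \<in> S \<Longrightarrow> nonneg_poly_in V (g x)) \<Longrightarrow> nonneg_poly_in V (prod g S)"
  by (induction S rule: infinite_finite_induct) (auto intro: nonneg_poly_in_mult)

lemma nonneg_poly_in_of_nat: "nonneg_poly_in V (of_nat n)"
  by (induction n) (auto intro: nonneg_poly_in_add)

lemma coeffwise_TP_D:
  "coeffwise_TP V r M \<Longrightarrow> k \<le> r \<Longrightarrow> strict_mono_on {..<k} \<rho> \<Longrightarrow> strict_mono_on {..<k} \<sigma>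
    \<Longrightarrow> nonneg_poly_in V (minor M k \<rho> \<sigma>)"
  by (simp add: coeffwise_TP_def)

lemma coeffwise_TP_I:
  assumes "\<And>k \<rho> \<sigma>. k \<le> r \<Longrightarrow> strict_mono_on {..<k} \<rho> \<Longrightarrow> strict_mono_on {..<k} \<sigma>
    \<Longrightarrow> nonneg_poly_in V (minor M k \<rho> \<sigma>)"
  shows "coeffwise_TP V r M"
  using assms by (simp add: coeffwise_TP_def)

lemma coeffwise_TP_UNIV: "coeffwise_TP V r M \<Longrightarrow> coeffwise_TP UNIV r M"
  unfolding coeffwise_TP_def by (blast intro: nonneg_poly_in_UNIV)

lemma coeffwise_TP_transpose:
  assumes "coeffwise_TP V r M"
  shows "coeffwise_TP V r (\<lambda>i j. M j i)"
  by (rule coeffwise_TP_I) (simp only: minor_transpose[of M] coeffwise_TP_D[OF assms])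

lemma coeffwise_TP_scale:
  assumes "coeffwise_TP V r M" "\<And>i. nonneg_poly_in V (d i)" "\<And>j. nonneg_poly_in V (e j)"
  shows "coeffwise_TP V r (\<lambda>i j. d i * e j * M i j)"
  using assms unfolding coeffwise_TP_def minor_scale
  by (auto intro!: nonneg_poly_in_mult nonneg_poly_in_prod)

text \<open>A minor sees only finitely many rows, so total positivity may be checked on approximants
  \<open>T\<close> that vary with \<open>n\<close>. This allows inductions on the number of correct
  rows.\<close>

lemma coeffwise_TP_if_rows_agree:
  assumes "\<And>n. \<exists>T. coeffwise_TP V r T \<and> (\<forall>i<n. T i = M i)"
  shows "coeffwise_TP V r M"
proof (rule coeffwise_TP_I)
  fix k and \<rho> \<sigma> :: "nat \<Rightarrow> nat"
  assume k: "k \<le> r" and \<rho>: "strict_mono_on {..<k} \<rho>" and \<sigma>: "strict_mono_on {..<k} \<sigma>"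
  \<comment> \<open>For \<open>k = 0\<close> the maximum is unspecified, but then there is no row
    index to bound.\<close>
  define n where "n = Suc (Max (\<rho> ` {..<k}))"
  have n: "\<rho> i < n" if "i < k" for i
    using that by (simp add: n_def le_imp_less_Suc)
  obtain T where T: "coeffwise_TP V r T" "\<forall>i<n. T i = M i"
    using assms by blast
  have "minor M k \<rho> \<sigma> = minor T k \<rho> \<sigma>"
    by (rule minor_cong) (use T n in auto)
  then show "nonneg_poly_in V (minor M k \<rho> \<sigma>)"
    using coeffwise_TP_D[OF T(1) k \<rho> \<sigma>] by simp
qed

section \<open>Products of totally positive matrices\<close>

lemma row_finite_bound:
  assumes "row_finite M"
  obtains n where "\<And>i l. i < m \<Longrightarrow> n \<le> l \<Longrightarrow> M i l = 0"
proof -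
  have "finite (\<Union>i<m. {j. M i j \<noteq> 0})"
    using assms by (simp add: row_finite_def)
  then obtain n where "\<And>l. l \<in> (\<Union>i<m. {j. M i j \<noteq> 0}) \<Longrightarrow> l < n"
    unfolding finite_nat_set_iff_bounded by blast
  then show ?thesis
    using that[of n] by fastforce
qed

lemma inf_mult_eq_sum:
  assumes "\<And>l. n \<le> l \<Longrightarrow> M i l = 0"
  shows "inf_mult M N i j = (\<Sum>l<n. M i l * N l j)"
  unfolding inf_mult_def
proof (rule Sum_any.expand_superset)
  show "{l. M i l * N l j \<noteq> 0} \<subseteq> {..<n}"
  proof
    fix l assume "l \<in> {l. M i l * N l j \<noteq> 0}"
    then have "M i l \<noteq> 0" by auto
    then show "l \<in> {..<n}"
      using assms[of l] by (cases "n \<le> l") auto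
  qed
qed simp

text \<open>The finitely many rows of \<open>M\<close> chosen by \<open>\<rho>\<close> vanish beyond
  a common \<open>n\<close>, so the minor is one of a product with inner dimension \<open>n\<close>.
  Every term of its Cauchy-Binet expansion is a product of two minors with increasing
  indices.\<close>

lemma coeffwise_TP_inf_mult:
  assumes "row_finite M" "coeffwise_TP V r M" "coeffwise_TP V r N"
  shows "coeffwise_TP V r (inf_mult M N)"
proof (rule coeffwise_TP_I)
  fix k and \<rho> \<sigma> :: "nat \<Rightarrow> nat"
  assume k: "k \<le> r" and \<rho>: "strict_mono_on {..<k} \<rho>" and \<sigma>: "strict_mono_on {..<k} \<sigma>"
  define m where "m = Suc (Max (\<rho> ` {..<k}))"
  have m: "\<rho> i < m" if "i < k" for i
    using that by (simp add: m_def le_imp_less_Suc)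
  obtain n where n: "\<And>i l. i < m \<Longrightarrow> n \<le> l \<Longrightarrow> M i l = 0"
    using row_finite_bound[OF assms(1)] by metis
  have "minor (inf_mult M N) k \<rho> \<sigma> = minor (\<lambda>i j. \<Sum>l<n. M i l * N l j) k \<rho> \<sigma>"
    by (rule minor_cong) (use m n in \<open>auto intro: inf_mult_eq_sum\<close>)
  moreover have "strict_mono_on {..<k} (enumerate S)" if "S \<subseteq> {..<n}" "card S = k" for S
    using that finite_subset[of S] by (auto simp: strict_mono_on_def intro!: finite_enumerate_mono)
  ultimately show "nonneg_poly_in V (minor (inf_mult M N) k \<rho> \<sigma>)"
    using assms k \<rho> \<sigma> unfolding Cauchy_Binet coeffwise_TP_def
    by (auto intro!: nonneg_poly_in_sum nonneg_poly_in_mult)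
qed

text \<open>Equivalently, the support is a chain in the componentwise order on positions, as for a
  bidiagonal matrix.\<close>

definition staircase :: "'a::zero inf_mat \<Rightarrow> bool" where
  "staircase M \<longleftrightarrow> (\<forall>i i' j j'. i < i' \<longrightarrow> j < j' \<longrightarrow> M i j' = 0 \<or> M i' j = 0)"

text \<open>A permutation other than the identity has an inversion, and an inversion picks two
  positions of which one carries a zero. Only the diagonal product survives in the Leibniz
  formula.\<close>

lemma coeffwise_TP_staircase:
  assumes "staircase M" and nonneg: "\<And>i j. nonneg_poly_in V (M i j)"
  shows "coeffwise_TP V r M"
proof (rule coeffwise_TP_I)
  fix k and \<rho> \<sigma> :: "nat \<Rightarrow> nat"
  assume k: "k \<le> r" and \<rho>: "strict_mono_on {..<k} \<rho>" and \<sigma>: "strict_mono_on {..<k} \<sigma>"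
  have "(\<Prod>i=0..<k. M (\<rho> i) (\<sigma> (p i))) = 0" if p: "p permutes {0..<k}" "p \<noteq> id" for p
  proof -
    have "\<exists>i i'. i < i' \<and> i' < k \<and> p i' < p i"
    proof (rule ccontr)
      assume "\<not> ?thesis"
      then have *: "p i \<le> p i'" if "i < i'" "i' < k" for i i'
        using that by (meson not_le)
      \<comment> \<open>Without inversions \<open>p\<close> is strictly increasing, hence
        \<open>i \<le> p i\<close> throughout, which forces a permutation of \<open>{0..<k}\<close>
        to be the identity.\<close>
      have "strict_mono_on {0..<k} p"
        unfolding strict_mono_on_def
        using * permutes_inj[OF p(1)] by (metis atLeastLessThan_iff injD le_neq_implies_less less_irrefl)
      have "i \<le> p i" if "i < k" for i
        using that
      proof (induction i)
        case (Suc i)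
        then show ?case
          using strict_mono_onD[OF \<open>strict_mono_on {0..<k} p\<close>, of i "Suc i"] by simp
      qed simp
      then have "i \<le> p i" if "i \<in> {0..<k}" for i
        using that by simp
      then have "p = id"
        using permutes_natset_ge[OF p(1)] by blast
      then show False using p(2) by blast
    qed
    then obtain i i' where i: "i < i'" "i' < k" "p i' < p i" by blast
    then have "\<rho> i < \<rho> i'"
      using \<rho> by (simp add: strict_mono_on_def)
    moreover have "p i < k"
      using permutes_in_image[OF p(1), of i] i by simp
    then have "\<sigma> (p i') < \<sigma> (p i)"
      using i \<sigma> by (simp add: strict_mono_on_def)
    ultimately have "M (\<rho> i) (\<sigma> (p i)) = 0 \<or> M (\<rho> i') (\<sigma> (p i')) = 0"
      using assms(1) unfolding staircase_def by blast
    moreover have "i \<in> {0..<k}" "i' \<in> {0..<k}"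
      using i by auto
    ultimately show ?thesis
      by (meson finite_atLeastLessThan prod_zero)
  qed
  then have "minor M k \<rho> \<sigma> = (\<Sum>p\<in>{id}. signof p * (\<Prod>i=0..<k. M (\<rho> i) (\<sigma> (p i))))"
    unfolding minor_alt by (intro sum.mono_neutral_right) (auto simp: finite_permutations permutes_id)
  then show "nonneg_poly_in V (minor M k \<rho> \<sigma>)"
    using nonneg by (simp add: nonneg_poly_in_prod)
qed

section \<open>Bordering by a unit row or a zero column\<close>

definition unit_row_above :: "'a::comm_ring_1 inf_mat \<Rightarrow> 'a inf_mat" where
  "unit_row_above M = (\<lambda>i j. case i of 0 \<Rightarrow> inf_one 0 j | Suc i' \<Rightarrow> M i' j)"

lemma unit_row_above_simps [simp]:
  "unit_row_above M 0 j = (if j = 0 then 1 else 0)" "unit_row_above M (Suc i) j = M i j"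
  by (auto simp: unit_row_above_def inf_one_def inf_diag_def)

text \<open>If row 0 is selected, it comes first and can be nonzero only in the first selected
  column; expansion along it leaves zero or a smaller minor of \<open>M\<close>. Otherwise the minor
  is one of \<open>M\<close> with row indices shifted by one.\<close>

lemma coeffwise_TP_unit_row_above:
  assumes "coeffwise_TP V r M"
  shows "coeffwise_TP V r (unit_row_above M)"
proof (rule coeffwise_TP_I)
  fix k and \<rho> \<sigma> :: "nat \<Rightarrow> nat"
  assume k: "k \<le> r" and \<rho>: "strict_mono_on {..<k} \<rho>" and \<sigma>: "strict_mono_on {..<k} \<sigma>"
  show "nonneg_poly_in V (minor (unit_row_above M) k \<rho> \<sigma>)"
  proof (cases k)
    case (Suc m)
    have pos: "0 < \<rho> i" if "0 < i" "i < k" for i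
      using \<rho> that by (metis bot_nat_0.not_eq_extremum lessThan_iff less_trans not_less0 strict_mono_onD)
    have pos': "0 < \<sigma> i" if "0 < i" "i < k" for i
      using \<sigma> that by (metis bot_nat_0.not_eq_extremum lessThan_iff less_trans not_less0 strict_mono_onD)
    show ?thesis
    proof (cases "\<rho> 0")
      case 0
      have "minor (unit_row_above M) (Suc m) \<rho> \<sigma>
          = (if \<sigma> 0 = 0 then 1 else 0) * minor (unit_row_above M) m (\<lambda>i. \<rho> (Suc i)) (\<lambda>j. \<sigma> (Suc j))"
        by (subst minor_row_eq_unit) (use 0 pos' Suc in auto)
      moreover have "minor (unit_row_above M) m (\<lambda>i. \<rho> (Suc i)) (\<lambda>j. \<sigma> (Suc j))
          = minor M m (\<lambda>i. \<rho> (Suc i) - 1) (\<lambda>j. \<sigma> (Suc j))"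
      proof (rule minor_cong)
        fix i j assume "i < m"
        then have "\<rho> (Suc i) = Suc (\<rho> (Suc i) - 1)"
          using pos[of "Suc i"] Suc by simp
        then show "unit_row_above M (\<rho> (Suc i)) (\<sigma> (Suc j)) = M (\<rho> (Suc i) - 1) (\<sigma> (Suc j))"
          by (metis unit_row_above_simps(2))
      qed
      moreover have "nonneg_poly_in V \<dots>"
      proof (rule coeffwise_TP_D[OF assms])
        show "strict_mono_on {..<m} (\<lambda>i. \<rho> (Suc i) - 1)"
        proof (rule strict_mono_onI)
          fix i j assume "i \<in> {..<m}" "j \<in> {..<m}" "i < j"
          then show "\<rho> (Suc i) - 1 < \<rho> (Suc j) - 1"
            using strict_mono_onD[OF \<rho>, of "Suc i" "Suc j"] pos[of "Suc i"] Suc by auto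
        qed
        show "strict_mono_on {..<m} (\<lambda>j. \<sigma> (Suc j))"
          using strict_mono_onD[OF \<sigma>] Suc by (auto intro!: strict_mono_onI)
      qed (use k Suc in simp)
      ultimately show ?thesis
        using Suc by simp
    next
      case (Suc l)
      then have pos: "0 < \<rho> i" if "i < k" for i
        using pos[of i] that by (cases i) auto
      have "minor (unit_row_above M) k \<rho> \<sigma> = minor M k (\<lambda>i. \<rho> i - 1) \<sigma>"
      proof (rule minor_cong)
        fix i j assume "i < k"
        then have "\<rho> i = Suc (\<rho> i - 1)"
          using pos by simp
        then show "unit_row_above M (\<rho> i) (\<sigma> j) = M (\<rho> i - 1) (\<sigma> j)"
          by (metis unit_row_above_simps(2))
      qed
      moreover have "strict_mono_on {..<k} (\<lambda>i. \<rho> i - 1)"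
      proof (rule strict_mono_onI)
        fix i j assume "i \<in> {..<k}" "j \<in> {..<k}" "i < j"
        then show "\<rho> i - 1 < \<rho> j - 1"
          using strict_mono_onD[OF \<rho>, of i j] pos[of i] by auto
      qed
      ultimately show ?thesis
        using coeffwise_TP_D[OF assms k] \<sigma> by simp
    qed
  qed simp
qed

text \<open>The direct sum of the 1 by 1 identity with \<open>M\<close> is
  \<open>unit_row_above (zero_col_before M)\<close>; splitting the bordering lets each step be
  checked on minors separately.\<close>

definition zero_col_before :: "'a::comm_ring_1 inf_mat \<Rightarrow> 'a inf_mat" where
  "zero_col_before M = (\<lambda>i j. case j of 0 \<Rightarrow> 0 | Suc j' \<Rightarrow> M i j')"

lemma zero_col_before_simps [simp]:
  "zero_col_before M i 0 = 0" "zero_col_before M i (Suc j) = M i j"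
  by (auto simp: zero_col_before_def)

lemma minor_zero_col:
  assumes "j < k" "\<And>i. i < k \<Longrightarrow> M (\<rho> i) (\<sigma> j) = 0"
  shows "minor M k \<rho> \<sigma> = 0"
proof -
  let ?A = "Matrix.mat k k (\<lambda>(i, j). M (\<rho> i) (\<sigma> j))"
  have "Determinant.det ?A = (\<Sum>i<k. ?A $$ (i, j) * cofactor ?A i j)"
    by (rule laplace_expansion_column) (use assms in auto)
  also have "\<dots> = 0"
    by (rule sum.neutral) (use assms in auto)
  finally show ?thesis by (simp add: minor_def)
qed

lemma coeffwise_TP_zero_col_before:
  assumes "coeffwise_TP V r M"
  shows "coeffwise_TP V r (zero_col_before M)"
proof (rule coeffwise_TP_I)
  fix k and \<rho> \<sigma> :: "nat \<Rightarrow> nat"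
  assume k: "k \<le> r" and \<rho>: "strict_mono_on {..<k} \<rho>" and \<sigma>: "strict_mono_on {..<k} \<sigma>"
  show "nonneg_poly_in V (minor (zero_col_before M) k \<rho> \<sigma>)"
  proof (cases "\<exists>j<k. \<sigma> j = 0")
    case True
    then obtain j where "j < k" "\<sigma> j = 0" by blast
    then have "minor (zero_col_before M) k \<rho> \<sigma> = 0"
      by (intro minor_zero_col[of j]) auto
    then show ?thesis by simp
  next
    case False
    then have pos: "0 < \<sigma> j" if "j < k" for j
      using that by auto
    have "minor (zero_col_before M) k \<rho> \<sigma> = minor M k \<rho> (\<lambda>j. \<sigma> j - 1)"
    proof (rule minor_cong)
      fix i j assume "j < k"
      then have "\<sigma> j = Suc (\<sigma> j - 1)"
        using pos by simp
      then show "zero_col_before M (\<rho> i) (\<sigma> j) = M (\<rho> i) (\<sigma> j - 1)"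
        by (metis zero_col_before_simps(2))
    qed
    moreover have "strict_mono_on {..<k} (\<lambda>j. \<sigma> j - 1)"
    proof (rule strict_mono_onI)
      fix i j assume "i \<in> {..<k}" "j \<in> {..<k}" "i < j"
      then show "\<sigma> i - 1 < \<sigma> j - 1"
        using strict_mono_onD[OF \<sigma>, of i j] pos[of i] by auto
    qed
    ultimately show ?thesis
      using coeffwise_TP_D[OF assms k \<rho>] by simp
  qed
qed

subsection \<open>Row-finite matrices and intertwining\<close>

lemma row_finite_inf_mult:
  assumes "row_finite M" "row_finite N"
  shows "row_finite (inf_mult M N)"
  unfolding row_finite_def
proof
  fix i
  obtain n where n: "\<And>l. n \<le> l \<Longrightarrow> M i l = 0"
    using row_finite_bound[OF assms(1), of "Suc i"] lessI by metis
  obtain m where m: "\<And>l j. l < n \<Longrightarrow> m \<le> j \<Longrightarrow> N l j = 0"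
    using row_finite_bound[OF assms(2), of n] by metis
  have "inf_mult M N i j = 0" if "m \<le> j" for j
    using m that by (simp add: inf_mult_eq_sum[where n = n] n)
  then have "{j. inf_mult M N i j \<noteq> 0} \<subseteq> {..<m}"
    by (metis (mono_tags) lessThan_iff linorder_not_le mem_Collect_eq subsetI)
  then show "finite {j. inf_mult M N i j \<noteq> 0}"
    using finite_subset by blast
qed

text \<open>Row-finiteness bounds both inner indices for a fixed row, so the claim becomes an
  exchange of two finite sums.\<close>

lemma inf_mult_assoc:
  assumes "row_finite M" "row_finite N"
  shows "inf_mult (inf_mult M N) K = inf_mult M (inf_mult N K)"
proof (intro ext)
  fix i j
  obtain n where n: "\<And>l. n \<le> l \<Longrightarrow> M i l = 0"
    using row_finite_bound[OF assms(1), of "Suc i"] lessI by metis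
  obtain m where m: "\<And>l j. l < n \<Longrightarrow> m \<le> j \<Longrightarrow> N l j = 0"
    using row_finite_bound[OF assms(2), of n] by metis
  have MN: "inf_mult M N i j = (\<Sum>l<n. M i l * N l j)" for j
    by (rule inf_mult_eq_sum) (rule n)
  have "inf_mult (inf_mult M N) K i j = (\<Sum>l'<m. (\<Sum>l<n. M i l * N l l') * K l' j)"
    by (subst inf_mult_eq_sum[where n = m]) (simp_all add: MN m)
  also have "\<dots> = (\<Sum>l<n. M i l * (\<Sum>l'<m. N l l' * K l' j))"
    by (simp add: sum_distrib_left sum_distrib_right mult.assoc) (rule sum.swap)
  also have "\<dots> = (\<Sum>l<n. M i l * inf_mult N K l j)"
    by (intro sum.cong refl) (simp add: inf_mult_eq_sum[where n = m] m)
  also have "\<dots> = inf_mult M (inf_mult N K) i j"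
    by (rule inf_mult_eq_sum[symmetric]) (rule n)
  finally show "inf_mult (inf_mult M N) K i j = inf_mult M (inf_mult N K) i j" .
qed

lemma inf_mult_one_left [simp]: "inf_mult inf_one M = M"
  by (intro ext) (simp add: inf_one_def inf_mult_diag_left)

lemma inf_mult_one_right [simp]: "inf_mult M inf_one = M"
  by (intro ext) (simp add: inf_one_def inf_mult_diag_right)

lemma row_finite_if_banded:
  assumes "\<And>i j. i + d < j \<Longrightarrow> M i j = 0"
  shows "row_finite M"
  unfolding row_finite_def
proof
  fix i
  have "{j. M i j \<noteq> 0} \<subseteq> {..i + d}"
    using assms not_le by (metis (mono_tags) atMost_iff mem_Collect_eq subsetI)
  then show "finite {j. M i j \<noteq> 0}"
    using finite_subset by blast
qed

lemma row_finite_inf_one: "row_finite inf_one"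
  by (rule row_finite_if_banded[of 0]) (simp add: inf_one_def inf_diag_def)

lemma row_finite_inf_power: "row_finite M \<Longrightarrow> row_finite (inf_power M n)"
  by (induction n) (simp_all add: row_finite_inf_one row_finite_inf_mult)

lemma inf_power_add:
  assumes "row_finite M"
  shows "inf_power M (m + n) = inf_mult (inf_power M m) (inf_power M n)"
  by (induction n) (simp_all add: inf_mult_assoc row_finite_inf_power assms)

lemma inf_power_Suc':
  assumes "row_finite M"
  shows "inf_power M (Suc n) = inf_mult M (inf_power M n)"
  using inf_power_add[OF assms, of 1 n] by simp

text \<open>The relation \<open>P B = B Q\<close> stands for conjugation by \<open>B\<close> and
  avoids constructing the inverse matrix.\<close>

lemma inf_mult_intertwine_power:
  assumes "row_finite P" "row_finite B" "row_finite Q" "inf_mult P B = inf_mult B Q"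
  shows "inf_mult (inf_power P n) B = inf_mult B (inf_power Q n)"
proof (induction n)
  case (Suc n)
  have "inf_mult (inf_power P (Suc n)) B = inf_mult (inf_power P n) (inf_mult B Q)"
    by (simp add: inf_mult_assoc row_finite_inf_power assms)
  also have "\<dots> = inf_mult (inf_mult B (inf_power Q n)) Q"
    by (simp add: inf_mult_assoc row_finite_inf_power assms flip: Suc)
  finally show ?case
    by (simp add: inf_mult_assoc row_finite_inf_power assms)
qed simp

lemma coeffwise_TP_inf_one: "coeffwise_TP V r inf_one"
  by (rule coeffwise_TP_staircase) (auto simp: staircase_def inf_one_def inf_diag_def)

text \<open>Moving \<open>B\<close> leftwards through the product replaces each factor by its
  totally positive partner in the same position; \<open>Q\<close> is the product of the
  partners.\<close>

lemma intertwine_inf_prod_list: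
  assumes "row_finite B"
    and "\<And>M. M \<in> set Ms \<Longrightarrow> row_finite M \<and>
      (\<exists>M'. row_finite M' \<and> coeffwise_TP V r M' \<and> inf_mult M B = inf_mult B M')"
  shows "row_finite (inf_prod_list Ms) \<and>
    (\<exists>Q. row_finite Q \<and> coeffwise_TP V r Q \<and> inf_mult (inf_prod_list Ms) B = inf_mult B Q)"
  using assms(2)
proof (induction Ms)
  case Nil
  have "inf_prod_list [] = inf_one" "inf_mult inf_one B = inf_mult B inf_one"
    by (simp_all add: inf_prod_list_def)
  then show ?case
    using coeffwise_TP_inf_one row_finite_inf_one by metis
next
  case (Cons M Ms)
  let ?P = "inf_prod_list Ms"
  obtain Q where P: "row_finite ?P" and Q: "row_finite Q" "coeffwise_TP V r Q" "inf_mult ?P B = inf_mult B Q"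
    using Cons by auto
  obtain M' where M: "row_finite M"
    and M': "row_finite M'" "coeffwise_TP V r M'" "inf_mult M B = inf_mult B M'"
    using Cons.prems[of M] by auto
  have eq: "inf_prod_list (M # Ms) = inf_mult M ?P"
    by (simp add: inf_prod_list_def)
  have "inf_mult (inf_mult M ?P) B = inf_mult M (inf_mult B Q)"
    by (simp add: inf_mult_assoc M P Q)
  also have "\<dots> = inf_mult (inf_mult B M') Q"
    by (simp add: inf_mult_assoc M assms(1) flip: M'(3))
  also have "\<dots> = inf_mult B (inf_mult M' Q)"
    by (simp add: inf_mult_assoc M' assms(1))
  finally show ?case
    unfolding eq
    by (intro conjI exI[of _ "inf_mult M' Q"] row_finite_inf_mult coeffwise_TP_inf_mult M P Q(1,2) M'(1,2))
qed

subsection \<open>Output matrices\<close>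

text \<open>The zero column in front of \<open>T\<close> meets exactly the unit row above
  \<open>M\<close>, so the two borders cancel.\<close>

lemma sum_shift_unit_row_above:
  "(\<Sum>l<Suc n. zero_col_before T i l * unit_row_above M l j) = (\<Sum>l<n. T i l * M l j)"
  by (subst sum.lessThan_Suc_shift) simp

lemma row_finite_unit_row_above:
  assumes "row_finite M"
  shows "row_finite (unit_row_above M)"
  unfolding row_finite_def
proof
  fix i
  show "finite {j. unit_row_above M i j \<noteq> 0}"
    using assms by (cases i) (auto simp: row_finite_def)
qed

lemma row_finite_zero_col_before:
  assumes "row_finite M"
  shows "row_finite (zero_col_before M)"
  unfolding row_finite_def
proof
  fix i
  have "{j. zero_col_before M i j \<noteq> 0} \<subseteq> Suc ` {j. M i j \<noteq> 0}"
  proof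
    fix j assume "j \<in> {j. zero_col_before M i j \<noteq> 0}"
    then show "j \<in> Suc ` {j. M i j \<noteq> 0}"
      by (cases j) auto
  qed
  then show "finite {j. zero_col_before M i j \<noteq> 0}"
    using assms finite_subset unfolding row_finite_def by blast
qed

text \<open>The output matrix \<open>A\<close> of \<open>P\<close> satisfies \<open>A = (1 \<oplus> A) P'\<close>, where \<open>P'\<close> is \<open>P\<close> below the row
  \<open>(1, 0, 0, \<dots>)\<close>. Row \<open>n + 1\<close> of \<open>A\<close> is thus obtained from row \<open>n\<close>, which gives an induction on
  the number of rows.\<close>

theorem coeffwise_TP_output_matrix:
  assumes P: "row_finite P" "coeffwise_TP V r P"
  shows "coeffwise_TP V r (output_matrix P)"
proof (rule coeffwise_TP_if_rows_agree)
  fix n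
  \<comment> \<open>Row-finiteness of \<open>T\<close> is carried along because \<open>T\<close>
    enters the left factor of the next product.\<close>
  have "\<exists>T. row_finite T \<and> coeffwise_TP V r T \<and> (\<forall>i<n. T i = output_matrix P i)"
  proof (induction n)
    case 0
    then show ?case
      using coeffwise_TP_inf_one row_finite_inf_one by blast
  next
    case (Suc n)
    then obtain T where T: "row_finite T" "coeffwise_TP V r T" "\<And>i. i < n \<Longrightarrow> T i = output_matrix P i"
      by blast
    let ?T = "inf_mult (unit_row_above (zero_col_before T)) (unit_row_above P)"
    have "?T i j = output_matrix P i j" if "i < Suc n" for i j
    proof (cases i)
      case 0
      have "?T 0 j = (\<Sum>l<Suc 0. unit_row_above (zero_col_before T) 0 l * unit_row_above P l j)"
        by (rule inf_mult_eq_sum) simp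
      then show ?thesis
        by (simp add: 0 output_matrix_def inf_one_def inf_diag_def)
    next
      case (Suc i')
      obtain m where m: "\<And>l. m \<le> l \<Longrightarrow> T i' l = 0"
        using row_finite_bound[OF T(1), of "Suc i'"] lessI by metis
      have "zero_col_before T i' l = 0" if "Suc m \<le> l" for l
        using that m by (cases l) auto
      then have "?T i j = (\<Sum>l<Suc m. unit_row_above (zero_col_before T) i l * unit_row_above P l j)"
        by (intro inf_mult_eq_sum) (simp add: Suc)
      also have "\<dots> = (\<Sum>l<m. T i' l * P l j)"
        unfolding Suc by (simp only: unit_row_above_simps sum_shift_unit_row_above)
      also have "\<dots> = inf_mult T P i' j"
        by (rule inf_mult_eq_sum[symmetric]) (rule m)
      also have "\<dots> = output_matrix P i j"
        using T(3)[of i'] that by (simp add: Suc output_matrix_def inf_mult_def)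
      finally show ?thesis .
    qed
    then have "\<forall>i<Suc n. ?T i = output_matrix P i"
      by blast
    moreover have "row_finite ?T"
      by (intro row_finite_inf_mult row_finite_unit_row_above row_finite_zero_col_before P T)
    moreover have "coeffwise_TP V r ?T"
      by (intro coeffwise_TP_inf_mult coeffwise_TP_unit_row_above coeffwise_TP_zero_col_before
          row_finite_unit_row_above row_finite_zero_col_before P T)
    ultimately show ?case by blast
  qed
  then show "\<exists>T. coeffwise_TP V r T \<and> (\<forall>i<n. T i = output_matrix P i)" by blast
qed

text \<open>The column analogue of the preceding theorem. Transposing \<open>P\<close> could destroy
  row-finiteness, so the recursion is run on columns instead: column \<open>m + 1\<close> is
  \<open>P\<close> times column \<open>m\<close>, and the approximants agree with the target on
  their first \<open>n\<close> columns.\<close>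

lemma coeffwise_TP_power_column:
  assumes P: "row_finite P" "coeffwise_TP V r P"
  shows "coeffwise_TP V r (\<lambda>k m. inf_power P m k 0)"
proof -
  let ?C = "\<lambda>k m. inf_power P m k 0"
  have "coeffwise_TP V r (\<lambda>m k. ?C k m)"
  proof (rule coeffwise_TP_if_rows_agree)
    fix n
    have "\<exists>T. coeffwise_TP V r T \<and> (\<forall>k. \<forall>m<n. T k m = ?C k m)"
    proof (induction n)
      case 0
      then show ?case
        using coeffwise_TP_inf_one by blast
    next
      case (Suc n)
      then obtain T where T: "coeffwise_TP V r T" "\<And>k m. m < n \<Longrightarrow> T k m = ?C k m"
        by blast
      \<comment> \<open>\<open>?D\<close> is \<open>P\<close> with the unit column prepended.
        Multiplying it by the direct sum of 1 and \<open>T\<close> keeps the unit column and applies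
        \<open>P\<close> to every column of \<open>T\<close>.\<close>
      let ?D = "\<lambda>i j. unit_row_above (\<lambda>i j. P j i) j i"
      let ?T = "inf_mult ?D (unit_row_above (zero_col_before T))"
      have D: "row_finite ?D"
        unfolding row_finite_def
      proof
        fix i
        have "{j. ?D i j \<noteq> 0} \<subseteq> insert 0 (Suc ` {j. P i j \<noteq> 0})"
        proof
          fix j assume "j \<in> {j. ?D i j \<noteq> 0}"
          then show "j \<in> insert 0 (Suc ` {j. P i j \<noteq> 0})"
            by (cases j) auto
        qed
        then show "finite {j. ?D i j \<noteq> 0}"
          using P(1) finite_subset unfolding row_finite_def by blast
      qed
      have "?T k m = ?C k m" if "m < Suc n" for k m
      proof -
        obtain N where N: "\<And>l. N \<le> l \<Longrightarrow> P k l = 0"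
          using row_finite_bound[OF P(1), of "Suc k"] lessI by metis
        have "?D k l = 0" if "Suc N \<le> l" for l
          using that N by (cases l) auto
        then have eq: "?T k m = (\<Sum>l<Suc N. ?D k l * unit_row_above (zero_col_before T) l m)"
          by (rule inf_mult_eq_sum)
        show ?thesis
        proof (cases m)
          case 0
          then show ?thesis
            unfolding eq by (subst sum.lessThan_Suc_shift) (simp add: inf_one_def inf_diag_def)
        next
          case (Suc m')
          have "?T k m = (\<Sum>l<N. P k l * T l m')"
            unfolding eq by (subst sum.lessThan_Suc_shift) (simp add: Suc)
          also have "\<dots> = (\<Sum>l<N. P k l * inf_power P m' l 0)"
            using T(2) that Suc by simp
          also have "\<dots> = inf_mult P (inf_power P m') k 0"
            by (rule inf_mult_eq_sum[symmetric]) (rule N)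
          finally show ?thesis
            \<comment> \<open>Here the new factor stands on the left, whereas
              \<open>inf_power\<close> recurses on the right.\<close>
            by (simp only: Suc inf_power_Suc'[OF P(1)])
        qed
      qed
      moreover have "coeffwise_TP V r ?T"
      proof (rule coeffwise_TP_inf_mult[OF D])
        show "coeffwise_TP V r ?D"
          by (rule coeffwise_TP_transpose[OF coeffwise_TP_unit_row_above[OF coeffwise_TP_transpose[OF P(2)]]])
        show "coeffwise_TP V r (unit_row_above (zero_col_before T))"
          by (intro coeffwise_TP_unit_row_above coeffwise_TP_zero_col_before T)
      qed
      ultimately show ?case by blast
    qed
    then obtain T where T: "coeffwise_TP V r T" "\<forall>k. \<forall>m<n. T k m = ?C k m" by blast
    show "\<exists>T. coeffwise_TP V r T \<and> (\<forall>m<n. T m = (\<lambda>k. ?C k m))"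
      by (rule exI[of _ "\<lambda>m k. T k m"]) (use T(2) coeffwise_TP_transpose[OF T(1)] in auto)
  qed
  from coeffwise_TP_transpose[OF this] show ?thesis .
qed

theorem coeffwise_Hankel_TP_output_matrix:
  assumes "row_finite P" "coeffwise_TP V r P"
  shows "coeffwise_Hankel_TP V r (\<lambda>n. output_matrix P n 0)"
proof -
  have "(\<lambda>n m. output_matrix P (n + m) 0) = inf_mult (output_matrix P) (\<lambda>k m. inf_power P m k 0)"
    by (intro ext) (simp add: output_matrix_def inf_power_add[OF assms(1)] inf_mult_def)
  \<comment> \<open>Row \<open>n\<close> of the output matrix is row 0 of the \<open>n\<close>-th
    power of \<open>P\<close>.\<close>
  moreover have "row_finite (output_matrix P)"
    using row_finite_inf_power[OF assms(1)] by (simp add: row_finite_def output_matrix_def)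
  ultimately show ?thesis
    unfolding coeffwise_Hankel_TP_def
    by (simp add: coeffwise_TP_inf_mult coeffwise_TP_output_matrix coeffwise_TP_power_column assms)
qed

subsection \<open>Total positivity of the factors\<close>

lemma coeffwise_TP_L_mat:
  assumes "nonneg_poly_in V a" "nonneg_poly_in V b" "nonneg_poly_in V c"
  shows "coeffwise_TP V r (L_mat a b c)"
proof (rule coeffwise_TP_staircase)
  show "staircase (L_mat a b c)"
    by (auto simp: staircase_def L_mat_def)
  show "nonneg_poly_in V (L_mat a b c i j)" for i j
    using assms by (auto simp: L_mat_def intro!: nonneg_poly_in_add nonneg_poly_in_mult nonneg_poly_in_of_nat
        simp del: of_nat_Suc)
qed

text \<open>For \<open>b = 0\<close> the matrix \<open>J\<close> is the product of an upper and a lower bidiagonal matrix, with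
  diagonals \<open>(a + l u) n\<close> and \<open>1\<close>. To account for the summand \<open>b\<close> times the identity matrix, its
  columns and rows are interleaved with those of the two factors; this keeps both factors
  staircase-shaped.\<close>

lemma J_mat_factorization:
  "J_mat a b u v l = inf_mult
     (\<lambda>n m. if m = 2 * n then (a + l * u) * of_nat n else if m = 2 * n + 1 then b
        else if m = 2 * n + 2 then u * of_nat n + u + v else 0)
     (\<lambda>m k. if m = 2 * k \<or> m = 2 * k + 1 then 1 else if m = 2 * k + 2 then l else 0)"
  (is "_ = inf_mult ?X ?Y")
proof (intro ext)
  fix n k
  have "inf_mult ?X ?Y n k = (\<Sum>m\<in>{2 * n, 2 * n + 1, 2 * n + 2}. ?X n m * ?Y m k)"
    unfolding inf_mult_def by (rule Sum_any.expand_superset) (auto split: if_splits)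
  also have "\<dots> = (a + l * u) * of_nat n * ?Y (2 * n) k + b * ?Y (2 * n + 1) k
      + (u * of_nat n + u + v) * ?Y (2 * n + 2) k"
    by (simp add: add.assoc)
  also have "\<dots> = J_mat a b u v l n k"
  proof -
    \<comment> \<open>The inner ranges \<open>2 * n, ..., 2 * n + 2\<close> and
      \<open>2 * k, ..., 2 * k + 2\<close> meet only for equal or neighbouring \<open>n\<close> and
      \<open>k\<close>, and neighbours share a single even index.\<close>
    consider "k = n" | "k = n + 1" | "n = k + 1" | "k \<noteq> n" "k \<noteq> n + 1" "n \<noteq> k + 1"
      by blast
    then show ?thesis
    proof cases
      case 4
      then have "2 * n + 1 \<noteq> 2 * k" "2 * n + 1 \<noteq> 2 * k + 2" "2 * n \<noteq> 2 * k + 1" "2 * n + 2 \<noteq> 2 * k + 1"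
        by presburger+
      then show ?thesis
        using 4 by (simp add: J_mat_def)
    next
      case 1
      have "2 * n + 1 \<noteq> 2 * n" "2 * n + 2 \<noteq> 2 * n" "2 * n + 2 \<noteq> 2 * n + 1" by auto
      then show ?thesis
        using 1 by (simp add: J_mat_def algebra_simps)
    next
      case 2
      then have "2 * n \<noteq> 2 * k" "2 * n \<noteq> 2 * k + 1" "2 * n \<noteq> 2 * k + 2"
        "2 * n + 1 \<noteq> 2 * k" "2 * n + 1 \<noteq> 2 * k + 1" "2 * n + 1 \<noteq> 2 * k + 2" "2 * n + 2 = 2 * k"
        by presburger+
      then show ?thesis
        using 2 by (simp add: J_mat_def)
    next
      case 3
      then have "2 * n = 2 * k + 2" "2 * n \<noteq> 2 * k" "2 * n \<noteq> 2 * k + 1"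
        "2 * n + 1 \<noteq> 2 * k" "2 * n + 1 \<noteq> 2 * k + 1" "2 * n + 1 \<noteq> 2 * k + 2"
        "2 * n + 2 \<noteq> 2 * k" "2 * n + 2 \<noteq> 2 * k + 1" "2 * n + 2 \<noteq> 2 * k + 2"
        by presburger+
      then show ?thesis
        using 3 by (simp add: J_mat_def algebra_simps)
    qed
  qed
  finally show "J_mat a b u v l n k = inf_mult ?X ?Y n k" ..
qed

text \<open>In the factorization, consecutive rows of the first factor, and consecutive columns of
  the second, overlap in one inner index only, so both supports are chains.\<close>

lemma coeffwise_TP_J_mat:
  assumes "nonneg_poly_in V a" "nonneg_poly_in V b" "nonneg_poly_in V u" "nonneg_poly_in V v"
    "nonneg_poly_in V l"
  shows "coeffwise_TP V r (J_mat a b u v l)"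
  unfolding J_mat_factorization
proof (rule coeffwise_TP_inf_mult, goal_cases)
  case 1
  show ?case
    unfolding row_finite_def
  proof
    fix n
    show "finite {m. (if m = 2 * n then (a + l * u) * of_nat n else if m = 2 * n + 1 then b
        else if m = 2 * n + 2 then u * of_nat n + u + v else 0) \<noteq> 0}"
      by (rule finite_subset[of _ "{..2 * n + 2}"]) auto
  qed
next
  case 2
  show ?case
    by (rule coeffwise_TP_staircase)
      (use assms in \<open>auto simp: staircase_def intro!: nonneg_poly_in_add nonneg_poly_in_mult nonneg_poly_in_of_nat\<close>)
next
  case 3
  show ?case
    by (rule coeffwise_TP_staircase) (use assms in \<open>auto simp: staircase_def\<close>)
qed

section \<open>Total positivity and commutation of the matrices \<open>Gamma_Lambda\<close>\<close>

lemma mp_const_mult: "mp_const c * mp_const d = mp_const (c * d)"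
  by (simp add: mp_const_def Poly_Mapping.mult_single)

lemma of_nat_eq_mp_const: "of_nat n = mp_const (real n)"
  by (induction n) (simp_all add: mp_const_def single_add flip: single_one)

text \<open>Conjugation by the factorial diagonal multiplies each minor by a nonnegative
  constant.\<close>

lemma coeffwise_TP_Gamma_Lambda:
  assumes "coeffwise_TP V r (toeplitz f)"
  shows "coeffwise_TP V r (Gamma_Lambda f)"
proof -
  have "Gamma_Lambda f = (\<lambda>i j. mp_const (fact i) * mp_const (1 / fact j) * toeplitz f i j)"
    by (intro ext) (simp add: Gamma_Lambda_entry mp_const_mult)
  then show ?thesis
    using assms by (simp add: coeffwise_TP_scale nonneg_poly_in_mp_const)
qed

lemma inf_mult_toeplitz: "inf_mult (toeplitz f) (toeplitz g) = toeplitz (f * g)"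
proof (intro ext)
  fix i j
  have "inf_mult (toeplitz f) (toeplitz g) i j = (\<Sum>l<Suc i. toeplitz f i l * toeplitz g l j)"
    by (rule inf_mult_eq_sum) (simp add: toeplitz_def)
  also have "\<dots> = toeplitz (f * g) i j"
  proof (cases "j \<le> i")
    case True
    have "(\<Sum>l<Suc i. toeplitz f i l * toeplitz g l j) = (\<Sum>l\<in>{j..i}. fps_nth f (i - l) * fps_nth g (l - j))"
      by (rule sum.mono_neutral_cong_right) (auto simp: toeplitz_def)
    also have "\<dots> = (\<Sum>m=0..i - j. fps_nth f m * fps_nth g (i - j - m))"
      by (rule sum.reindex_bij_witness[of _ "\<lambda>m. i - m" "\<lambda>l. i - l"]) (use True in auto)
    finally show ?thesis
      using True by (simp add: toeplitz_def fps_mult_nth)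
  qed (auto simp: toeplitz_def)
  finally show "inf_mult (toeplitz f) (toeplitz g) i j = toeplitz (f * g) i j" .
qed

text \<open>The inner factorials cancel, leaving the Toeplitz product. Commutativity of power series
  multiplication thus makes all these matrices commute.\<close>

lemma inf_mult_Gamma_Lambda: "inf_mult (Gamma_Lambda f) (Gamma_Lambda g) = Gamma_Lambda (f * g)"
proof (intro ext)
  fix i j
  have c: "mp_const (fact i / fact l) * x * (mp_const (fact l / fact j) * y) = mp_const (fact i / fact j) * (x * y)"
    for l :: nat and x y
  proof -
    have "mp_const (fact i / fact l) * x * (mp_const (fact l / fact j) * y)
        = (mp_const (fact i / fact l) * mp_const (fact l / fact j)) * (x * y)"
      by (simp only: mult_ac)
    then show ?thesis by (simp add: mp_const_mult)
  qed
  have "inf_mult (Gamma_Lambda f) (Gamma_Lambda g) i j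
      = (\<Sum>l<Suc i. Gamma_Lambda f i l * Gamma_Lambda g l j)"
    by (rule inf_mult_eq_sum) (simp add: Gamma_Lambda_entry toeplitz_def)
  also have "\<dots> = mp_const (fact i / fact j) * (\<Sum>l<Suc i. toeplitz f i l * toeplitz g l j)"
    by (simp only: Gamma_Lambda_entry c sum_distrib_left)
  also have "(\<Sum>l<Suc i. toeplitz f i l * toeplitz g l j) = inf_mult (toeplitz f) (toeplitz g) i j"
    by (rule inf_mult_eq_sum[symmetric]) (simp add: toeplitz_def)
  finally show "inf_mult (Gamma_Lambda f) (Gamma_Lambda g) i j = Gamma_Lambda (f * g) i j"
    by (simp only: Gamma_Lambda_entry[of "f * g" i j] inf_mult_toeplitz)
qed

text \<open>The series is the exponential series of \<open>q t\<close>.\<close>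

lemma binomial_matrix_eq_Gamma_Lambda:
  "binomial_matrix q = Gamma_Lambda (Abs_fps (\<lambda>m. mp_const (1 / fact m) * q ^ m))"
proof (intro ext)
  fix n k
  show "binomial_matrix q n k = Gamma_Lambda (Abs_fps (\<lambda>m. mp_const (1 / fact m) * q ^ m)) n k"
  proof (cases "k \<le> n")
    case True
    have "mp_const (fact n / fact k) * (mp_const (1 / fact (n - k)) * q ^ (n - k))
        = mp_const (fact n / fact k * (1 / fact (n - k))) * q ^ (n - k)"
      by (simp only: mult.assoc[symmetric] mp_const_mult)
    also have "fact n / fact k * (1 / fact (n - k)) = real (n choose k)"
      by (simp add: binomial_fact True)
    finally show ?thesis
      using True by (simp add: binomial_matrix_def Gamma_Lambda_entry toeplitz_def of_nat_eq_mp_const)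
  qed (simp add: binomial_matrix_def Gamma_Lambda_entry toeplitz_def)
qed

lemma Gamma_Lambda_binomial_matrix_commute:
  "inf_mult (Gamma_Lambda f) (binomial_matrix q) = inf_mult (binomial_matrix q) (Gamma_Lambda f)"
  by (simp add: binomial_matrix_eq_Gamma_Lambda inf_mult_Gamma_Lambda mult.commute)

subsection \<open>Conjugation by the binomial matrix\<close>

text \<open>The case distinction is essential: for \<open>i = 0\<close> truncated subtraction gives
  \<open>i - 1 = 0\<close>, and the diagonal term would be counted twice.\<close>

lemma inf_mult_tridiagonal_left:
  assumes "\<And>l. l \<noteq> i \<Longrightarrow> l \<noteq> i + 1 \<Longrightarrow> i \<noteq> l + 1 \<Longrightarrow> M i l = 0"
  shows "inf_mult M N i j
    = (if i = 0 then 0 else M i (i - 1) * N (i - 1) j) + M i i * N i j + M i (i + 1) * N (i + 1) j"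
proof (cases i)
  case 0
  have "inf_mult M N i j = (\<Sum>l\<in>{0, 1}. M i l * N l j)"
    unfolding inf_mult_def
  proof (rule Sum_any.expand_superset)
    show "{l. M i l * N l j \<noteq> 0} \<subseteq> {0, 1}"
    proof
      fix l assume "l \<in> {l. M i l * N l j \<noteq> 0}"
      then have "M i l \<noteq> 0" by auto
      then have "l = i \<or> l = i + 1 \<or> i = l + 1"
        using assms by blast
      then show "l \<in> {0, 1}"
        using 0 by auto
    qed
  qed simp
  then show ?thesis by (simp add: 0)
next
  case (Suc i')
  have "inf_mult M N i j = (\<Sum>l\<in>{i', Suc i', Suc (Suc i')}. M i l * N l j)"
    unfolding inf_mult_def
  proof (rule Sum_any.expand_superset)
    show "{l. M i l * N l j \<noteq> 0} \<subseteq> {i', Suc i', Suc (Suc i')}"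
    proof
      fix l assume "l \<in> {l. M i l * N l j \<noteq> 0}"
      then have "M i l \<noteq> 0" by auto
      then have "l = i \<or> l = i + 1 \<or> i = l + 1"
        using assms by blast
      then show "l \<in> {i', Suc i', Suc (Suc i')}"
        using Suc by auto
    qed
  qed simp
  then show ?thesis by (simp add: Suc add.assoc)
qed

lemma inf_mult_tridiagonal_right:
  assumes "\<And>l. l \<noteq> j \<Longrightarrow> l \<noteq> j + 1 \<Longrightarrow> j \<noteq> l + 1 \<Longrightarrow> N l j = 0"
  shows "inf_mult M N i j
    = (if j = 0 then 0 else M i (j - 1) * N (j - 1) j) + M i j * N j j + M i (j + 1) * N (j + 1) j"
proof -
  have "inf_mult M N i j = inf_mult (\<lambda>i j. N j i) (\<lambda>i j. M j i) j i"
    by (simp add: inf_mult_def mult.commute)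
  also have "\<dots> = (if j = 0 then 0 else N (j - 1) j * M i (j - 1)) + N j j * M i j + N (j + 1) j * M i (j + 1)"
    by (rule inf_mult_tridiagonal_left) (rule assms)
  finally show ?thesis by (simp add: mult.commute)
qed

text \<open>Row \<open>n\<close> of the matrix lists the coefficients of \<open>(t + q)^n\<close>.
  This is multiplication by \<open>t + q\<close>, that is, Pascal's rule.\<close>

lemma binomial_matrix_Suc:
  "binomial_matrix q (Suc n) k = (if k = 0 then 0 else binomial_matrix q n (k - 1)) + q * binomial_matrix q n k"
proof (cases k)
  case (Suc k')
  show ?thesis
  proof (cases "k \<le> n")
    case True
    then have "n - k' = Suc (n - k)"
      using Suc by simp
    then show ?thesis
      using True Suc by (simp add: binomial_matrix_def algebra_simps)
  next
    case False
    then show ?thesis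
      using Suc by (auto simp: binomial_matrix_def not_le less_Suc_eq binomial_eq_0)
  qed
qed (simp add: binomial_matrix_def)

text \<open>Differentiation of \<open>(t + q)^n\<close>, read off at \<open>t^k\<close>.\<close>

lemma binomial_matrix_absorb:
  "(if n = 0 then 0 else of_nat n * binomial_matrix q (n - 1) k) = of_nat (Suc k) * binomial_matrix q n (Suc k)"
proof (cases n)
  case (Suc m)
  have "(of_nat (Suc k) * of_nat (Suc m choose Suc k) :: 'a) = of_nat (Suc m) * of_nat (m choose k)"
    by (simp only: of_nat_mult[symmetric] Suc_times_binomial_eq mult.commute)
  then show ?thesis
    using Suc by (auto simp: binomial_matrix_def mult.assoc[symmetric] simp del: of_nat_Suc)
qed (simp add: binomial_matrix_def)

text \<open>The operator \<open>(t + q) d/dt\<close> multiplies \<open>(t + q)^n\<close> by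
  \<open>n\<close>; compare coefficients of \<open>t^k\<close>.\<close>

lemma binomial_matrix_diag:
  "of_nat n * binomial_matrix q n k
     = of_nat k * binomial_matrix q n k + q * (of_nat (Suc k) * binomial_matrix q n (Suc k))"
proof (cases "k < n")
  case True
  then obtain m where n: "n = Suc m" "k \<le> m"
    by (cases n) auto
  have "(n - k) * (n choose k) = Suc k * (n choose Suc k)"
    using binomial_absorb_comp[of n k] Suc_times_binomial_eq[of m k] by (simp add: n mult.commute)
  then have *: "(of_nat (n - k) * of_nat (n choose k) :: 'a) = of_nat (Suc k) * of_nat (n choose Suc k)"
    by (metis of_nat_mult)
  have "n - k = Suc (n - Suc k)"
    using True by simp
  then have pow: "q ^ (n - k) = q * q ^ (n - Suc k)"
    by (metis power_Suc)
  have "of_nat n * binomial_matrix q n k = of_nat k * binomial_matrix q n k + of_nat (n - k) * binomial_matrix q n k"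
    using True by (simp add: of_nat_diff algebra_simps)
  also have "of_nat (n - k) * binomial_matrix q n k = (of_nat (n - k) * of_nat (n choose k)) * q ^ (n - k)"
    using True by (simp add: binomial_matrix_def mult.assoc)
  also have "\<dots> = q * (of_nat (Suc k) * binomial_matrix q n (Suc k))"
    using True unfolding * pow by (simp add: binomial_matrix_def mult_ac)
  finally show ?thesis .
qed (auto simp: binomial_matrix_def)

text \<open>The binomial identities remove the row index \<open>n\<close> from the coefficients.
  What remains is a combination of neighbouring entries of row \<open>n\<close> of \<open>?B\<close>
  with weights depending on \<open>k\<close> alone, which form column \<open>k\<close> of the right
  factor.\<close>

lemma L_mat_binomial_matrix:
  "inf_mult (L_mat a b c) (binomial_matrix q) = inf_mult (binomial_matrix q) (L_mat a b (c + q * a))"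
proof (intro ext)
  fix n k
  let ?B = "binomial_matrix q"
  define y z where "y = ?B n k" and "z = of_nat (Suc k) * ?B n (Suc k)"
  have "inf_mult (L_mat a b c) ?B n k = c * (if n = 0 then 0 else of_nat n * ?B (n - 1) k) + (of_nat n * a + b) * y"
    by (subst inf_mult_tridiagonal_left) (auto simp: L_mat_def y_def algebra_simps)
  also have "\<dots> = c * z + a * (of_nat n * y) + b * y"
    unfolding binomial_matrix_absorb z_def[symmetric] by (simp add: algebra_simps)
  also have "of_nat n * y = of_nat k * y + q * z"
    unfolding y_def z_def by (rule binomial_matrix_diag)
  also have "c * z + a * (of_nat k * y + q * z) + b * y = y * (of_nat k * a + b) + z * (c + q * a)"
    by (simp add: algebra_simps)
  also have "\<dots> = inf_mult ?B (L_mat a b (c + q * a)) n k"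
    by (subst inf_mult_tridiagonal_right) (auto simp: L_mat_def y_def z_def algebra_simps)
  finally show "inf_mult (L_mat a b c) ?B n k = inf_mult ?B (L_mat a b (c + q * a)) n k" .
qed

lemma J_mat_binomial_matrix:
  "inf_mult (J_mat a b u v l) (binomial_matrix q) = inf_mult (binomial_matrix q) (J_mat a b u v (l + q))"
proof (intro ext)
  fix n k
  let ?B = "binomial_matrix q"
  define x y z where "x = (if k = 0 then 0 else ?B n (k - 1))" and "y = ?B n k"
    and "z = of_nat (Suc k) * ?B n (Suc k)"
  have ny: "of_nat n * y = of_nat k * y + q * z"
    unfolding y_def z_def by (rule binomial_matrix_diag)
  \<comment> \<open>The diagonal identity in column \<open>k - 1\<close>, with the factor
    \<open>k - 1\<close> written as a difference in the ring so that the case \<open>k = 0\<close>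
    holds trivially.\<close>
  have nx: "of_nat n * x = of_nat k * x - x + q * (of_nat k * y)"
    using binomial_matrix_diag[of n q "k - 1"] by (cases k) (auto simp: x_def y_def algebra_simps)
  have "inf_mult (J_mat a b u v l) ?B n k
      = l * (a + l * u) * (if n = 0 then 0 else of_nat n * ?B (n - 1) k)
        + ((2 * l * u + a) * of_nat n + b + l * (u + v)) * y + (u * of_nat n + u + v) * ?B (Suc n) k"
    by (subst inf_mult_tridiagonal_left) (auto simp: J_mat_def y_def mult.assoc)
  also have "\<dots> = l * (a + l * u) * z + (2 * l * u + a) * (of_nat n * y) + (b + l * (u + v)) * y
      + u * (of_nat n * x) + u * q * (of_nat n * y) + (u + v) * (x + q * y)"
    unfolding binomial_matrix_absorb binomial_matrix_Suc x_def[symmetric] y_def[symmetric] z_def[symmetric]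
    by (simp add: algebra_simps)
  also have "\<dots> = x * (u * of_nat k + v)
      + y * ((2 * (l + q) * u + a) * of_nat k + b + (l + q) * (u + v))
      + z * ((l + q) * (a + (l + q) * u))"
    unfolding ny nx by (simp add: algebra_simps)
  also have "\<dots> = inf_mult ?B (J_mat a b u v (l + q)) n k"
  proof (subst inf_mult_tridiagonal_right, goal_cases)
    case 2
    show ?case
      by (cases k) (auto simp: J_mat_def x_def y_def z_def algebra_simps)
  qed (auto simp: J_mat_def)
  finally show "inf_mult (J_mat a b u v l) ?B n k = inf_mult ?B (J_mat a b u v (l + q)) n k" .
qed

text \<open>Intertwining with the binomial matrix leads out of the upper bidiagonal form, to a
  \<open>J_mat\<close> with last parameter \<open>q\<close>; hence \<open>U_mat\<close> is treated
  as a special \<open>J_mat\<close>.\<close>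

lemma U_mat_eq_J_mat: "U_mat a b u v = J_mat a b u v 0"
  by (intro ext) (auto simp: U_mat_def J_mat_def algebra_simps)

lemma row_finite_L_mat: "row_finite (L_mat a b c)"
  by (rule row_finite_if_banded[of 0]) (auto simp: L_mat_def)

lemma row_finite_J_mat: "row_finite (J_mat a b u v l)"
  by (rule row_finite_if_banded[of 1]) (auto simp: J_mat_def)

lemma row_finite_Gamma_Lambda: "row_finite (Gamma_Lambda f)"
  by (rule row_finite_if_banded[of 0]) (auto simp: Gamma_Lambda_entry toeplitz_def)

lemma row_finite_binomial_matrix: "row_finite (binomial_matrix q)"
  by (rule row_finite_if_banded[of 0]) (auto simp: binomial_matrix_def)

section \<open>Assembly: the factors, their product and its output matrix\<close>

lemma factor_matrices_intertwine:
  assumes "\<And>i. i \<ge> 1 \<Longrightarrow> polya_frequency x_indets r (f i)" "M \<in> factor_matrices f"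
  shows "row_finite M \<and> (\<exists>M'. row_finite M' \<and> coeffwise_TP UNIV r M' \<and>
    inf_mult M (binomial_matrix (mp_var IQ)) = inf_mult (binomial_matrix (mp_var IQ)) M')"
proof -
  let ?B = "binomial_matrix (mp_var IQ)"
  note nonneg = nonneg_poly_in_add nonneg_poly_in_mult nonneg_poly_in_mp_var[OF UNIV_I] nonneg_poly_in_0
  obtain i where i: "i \<ge> 1" and "M = L_fac i \<or> M = U_fac i \<or> M = J_fac i \<or> M = Gamma_Lambda (f i)"
    using assms(2) by (auto simp: factor_matrices_def)
  then consider "M = L_fac i" | "M = U_fac i" | "M = J_fac i" | "M = Gamma_Lambda (f i)"
    by blast
  then show ?thesis
  proof cases
    case 1
    have "coeffwise_TP UNIV r (L_mat (mp_var (La i)) (mp_var (Lb i)) (mp_var (Lc i) + mp_var IQ * mp_var (La i)))"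
      by (intro coeffwise_TP_L_mat nonneg)
    then show ?thesis
      unfolding 1 L_fac_def using row_finite_L_mat L_mat_binomial_matrix by blast
  next
    case 2
    have "coeffwise_TP UNIV r (J_mat (mp_var (Ua i)) (mp_var (Ub i)) (mp_var (Uu i)) (mp_var (Uv i)) (0 + mp_var IQ))"
      by (intro coeffwise_TP_J_mat nonneg)
    then show ?thesis
      unfolding 2 U_fac_def U_mat_eq_J_mat using row_finite_J_mat J_mat_binomial_matrix by blast
  next
    case 3
    have "coeffwise_TP UNIV r
        (J_mat (mp_var (Ja i)) (mp_var (Jb i)) (mp_var (Ju i)) (mp_var (Jv i)) (mp_var (Jl i) + mp_var IQ))"
      by (intro coeffwise_TP_J_mat nonneg)
    then show ?thesis
      unfolding 3 J_fac_def using row_finite_J_mat J_mat_binomial_matrix by blast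
  next
    case 4
    \<comment> \<open>By commutation this factor is its own partner; its indeterminates are widened
      from \<open>x_indets\<close> to \<open>UNIV\<close>.\<close>
    have "coeffwise_TP UNIV r (Gamma_Lambda (f i))"
      using assms(1)[OF i] coeffwise_TP_Gamma_Lambda coeffwise_TP_UNIV
      unfolding polya_frequency_def by blast
    then show ?thesis
      unfolding 4 using row_finite_Gamma_Lambda Gamma_Lambda_binomial_matrix_commute by blast
  qed
qed

lemma inf_mult_output_matrix_binomial_matrix:
  assumes "row_finite P" "row_finite Q" "inf_mult P (binomial_matrix q) = inf_mult (binomial_matrix q) Q"
  shows "inf_mult (output_matrix P) (binomial_matrix q) = output_matrix Q"
proof (intro ext)
  fix n k
  let ?B = "binomial_matrix q"
  have "inf_mult (output_matrix P) ?B n k = inf_mult (inf_power P n) ?B 0 k"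
    by (simp add: inf_mult_def output_matrix_def)
  also have "\<dots> = inf_mult ?B (inf_power Q n) 0 k"
    by (simp add: inf_mult_intertwine_power[OF assms(1) row_finite_binomial_matrix assms(2,3)])
  also have "\<dots> = (\<Sum>l<Suc 0. ?B 0 l * inf_power Q n l k)"
    by (rule inf_mult_eq_sum) (simp add: binomial_matrix_def)
  finally show "inf_mult (output_matrix P) ?B n k = output_matrix Q n k"
    by (simp add: binomial_matrix_def output_matrix_def)
qed

text \<open>Column 0 of the binomial matrix consists of the powers of \<open>q\<close>.\<close>

lemma row_gen_poly_eq_inf_mult: "row_gen_poly A q n = inf_mult A (binomial_matrix q) n 0"
  by (simp add: row_gen_poly_def inf_mult_def binomial_matrix_def)

theorem theorem2p3:
  fixes P A :: "'x indet real_mpoly inf_mat"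
    and f :: "nat \<Rightarrow> 'x indet real_mpoly fps"
    and Ms :: "'x indet real_mpoly inf_mat list"
    and r :: nat
  assumes "row_finite P \<or> col_finite P"
    and "A = output_matrix P"
    and "\<And>i. i \<ge> 1 \<Longrightarrow> polya_frequency x_indets r (f i)"
    and "set Ms \<subseteq> factor_matrices f"
    and "P = inf_prod_list Ms"
  shows "coeffwise_TP UNIV r (inf_mult A (binomial_matrix (mp_var IQ)))
       \<and> coeffwise_Hankel_TP UNIV r (row_gen_poly A (mp_var IQ))"
proof -
  let ?B = "binomial_matrix (mp_var IQ)"
  have fac: "row_finite M \<and> (\<exists>M'. row_finite M' \<and> coeffwise_TP UNIV r M' \<and> inf_mult M ?B = inf_mult ?B M')"
    if "M \<in> set Ms" for M
    by (rule factor_matrices_intertwine[where f = f]) (use assms(3,4) that in auto)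
  obtain Q where P: "row_finite P" and Q: "row_finite Q" "coeffwise_TP UNIV r Q" "inf_mult P ?B = inf_mult ?B Q"
    using intertwine_inf_prod_list[OF row_finite_binomial_matrix fac] unfolding assms(5) by blast
  have AB: "inf_mult A ?B = output_matrix Q"
    unfolding assms(2) by (rule inf_mult_output_matrix_binomial_matrix[OF P Q(1,3)])
  have "row_gen_poly A (mp_var IQ) = (\<lambda>n. output_matrix Q n 0)"
    by (intro ext) (simp add: row_gen_poly_eq_inf_mult AB)
  then show ?thesis
    using coeffwise_TP_output_matrix[OF Q(1,2)] coeffwise_Hankel_TP_output_matrix[OF Q(1,2)] AB by simp
qed

end
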